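(* Let $p$ be a prime number and let $q = p^f$ with $f \geq 1$. The functional equation $$\sum_{j=0}^{\infty} p^{-j}\Psi(p^{j} T)^{q^{j}} = T$$ has a unique solution $\Psi = \Psi_q \in T + T^2\mathbb{Z}[[T]]$.
   Context: Convergence of the infinite sum is with respect to the $T$-adic topology of formal power series. *)

theory Defs
  imports "HOL-Computational_Algebra.Computational_Algebra"
begin

text \<open>
  The functional equation involves the coefficients \<open>p\<^sup>-\<^sup>j\<close>, so everything takes place in
  \<open>\<rat>[[T]]\<close>, and \<open>\<int>[[T]]\<close> is regarded as a subring of it. The library's metric on
  formal power series induces the \<open>T\<close>-adic topology, so \<open>(sums)\<close> is \<open>T\<close>-adic convergence
  of the partial sums.
\<close>

definition fps_of_int_fps :: "int fps \<Rightarrow> rat fps" where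
  "fps_of_int_fps g = Abs_fps (\<lambda>n. of_int (fps_nth g n))"

definition T_plus_T2_int_fps :: "rat fps set" where
  "T_plus_T2_int_fps = {fps_X + fps_X ^ 2 * fps_of_int_fps g | g. True}"

definition solves_Psi_equation :: "nat \<Rightarrow> nat \<Rightarrow> rat fps \<Rightarrow> bool" where
  "solves_Psi_equation p q \<Psi> \<longleftrightarrow>
     (\<lambda>j. fps_const (inverse (of_nat p ^ j)) * (fps_compose \<Psi> (fps_const (of_nat p ^ j) * fps_X)) ^ (q ^ j))
       sums fps_X"

end

theory Submission
  imports Defs
begin

text \<open>
  The coefficient of \<open>T\<^sup>n\<close> in the \<open>j\<close>-th summand is \<open>p\<^bsup>j(n-1)\<^esup>\<close> times that of \<open>\<Psi>\<^bsup>q^j\<^esup>\<close>: it is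
  integral for integral \<open>\<Psi>\<close> and \<open>n \<ge> 1\<close>. If \<open>\<Psi>\<close> has no constant term, it vanishes for \<open>q\<^sup>j > n\<close>,
  and for \<open>j \<ge> 1\<close> it only involves coefficients of \<open>\<Psi>\<close> of index less than \<open>n\<close>. Hence the equation
  is a recursion that determines the coefficients of \<open>\<Psi>\<close> one after the other.
\<close>

text \<open>Turns membership into coefficientwise conditions, which the recursion can verify one
  index at a time.\<close>

lemma mem_T_plus_T2_int_fps_iff:
  "\<Psi> \<in> T_plus_T2_int_fps \<longleftrightarrow> \<Psi> $ 0 = 0 \<and> \<Psi> $ 1 = 1 \<and> (\<forall>n. \<Psi> $ n \<in> \<int>)"
proof
  assume "\<Psi> \<in> T_plus_T2_int_fps"
  then obtain g where "\<Psi> = fps_X + fps_X ^ 2 * fps_of_int_fps g"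
    by (auto simp: T_plus_T2_int_fps_def)
  then show "\<Psi> $ 0 = 0 \<and> \<Psi> $ 1 = 1 \<and> (\<forall>n. \<Psi> $ n \<in> \<int>)"
    by (auto simp: fps_X_power_mult_nth fps_of_int_fps_def)
next
  assume *: "\<Psi> $ 0 = 0 \<and> \<Psi> $ 1 = 1 \<and> (\<forall>n. \<Psi> $ n \<in> \<int>)"
  \<comment> \<open>Each coefficient is integral, so the floor only changes its type to
    \<open>int\<close>; the shift by 2 undoes the factor \<open>fps_X ^ 2\<close>.\<close>
  define g where "g = Abs_fps (\<lambda>n. \<lfloor>\<Psi> $ (n + 2)\<rfloor>)"
  have "\<Psi> = fps_X + fps_X ^ 2 * fps_of_int_fps g"
  proof (rule fps_ext)
    fix n :: nat
    consider "n = 0" | "n = 1" | m where "n = Suc (Suc m)"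
      by (metis One_nat_def not0_implies_Suc)
    then show "\<Psi> $ n = (fps_X + fps_X ^ 2 * fps_of_int_fps g) $ n"
      using * by cases (auto simp: fps_X_power_mult_nth fps_of_int_fps_def g_def)
  qed
  then show "\<Psi> \<in> T_plus_T2_int_fps"
    by (auto simp: T_plus_T2_int_fps_def)
qed

lemma fps_power_nth_cong:
  fixes F G :: "'a::semiring_1 fps"
  assumes "\<And>k. k \<le> n \<Longrightarrow> F $ k = G $ k"
  shows "(F ^ m) $ n = (G ^ m) $ n"
  using assms
proof (induction m arbitrary: n)
  case (Suc m)
  then show ?case
    by (auto simp: fps_mult_nth intro!: sum.cong arg_cong2[where f = "(*)"])
qed simp

text \<open>Without constant term, the coefficient of \<open>T\<^sup>n\<close> only enters that of a power of exponent
  at least two multiplied by a vanishing constant term.\<close>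

lemma fps_power_nth_cong_less:
  fixes F G :: "'a::semiring_1 fps"
  assumes "F $ 0 = 0" "G $ 0 = 0" "m \<ge> 2" and eq: "\<And>k. k < n \<Longrightarrow> F $ k = G $ k"
  shows "(F ^ m) $ n = (G ^ m) $ n"
proof -
  obtain l where m: "m = Suc l" and l: "l > 0"
    using \<open>m \<ge> 2\<close> by (cases m) auto
  have "F $ i * (F ^ l) $ (n - i) = G $ i * (G ^ l) $ (n - i)" if "i \<le> n" for i
  proof -
    consider "i = 0" | "i = n" | "0 < i" "i < n"
      using \<open>i \<le> n\<close> by linarith
    then show ?thesis
    proof cases
      case 3
      have "(F ^ l) $ (n - i) = (G ^ l) $ (n - i)"
        using 3 by (intro fps_power_nth_cong eq) simp
      with 3 eq show ?thesis by simp
    qed (use assms l in \<open>simp_all add: fps_nth_power_0 zero_power\<close>)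
  qed
  then show ?thesis
    by (auto simp: m fps_mult_nth intro!: sum.cong)
qed

lemma fps_power_nth_Ints:
  assumes "\<And>k. k \<le> n \<Longrightarrow> F $ k \<in> \<int>"
  shows "(F ^ m) $ n \<in> \<int>"
  using assms
proof (induction m arbitrary: n)
  case (Suc m)
  then show ?case
    by (auto simp: fps_mult_nth intro!: Ints_sum Ints_mult)
qed simp

lemma less_power_power:
  fixes q n j :: nat
  assumes "q \<ge> 2" "n \<le> j"
  shows "n < q ^ j"
proof -
  have "n < 2 ^ n" by (rule less_exp)
  also have "\<dots> \<le> 2 ^ j" using assms by (intro power_increasing) auto
  also have "\<dots> \<le> q ^ j" using assms by (intro power_mono) auto
  finally show ?thesis .
qed

definition Psi_term :: "nat \<Rightarrow> nat \<Rightarrow> rat fps \<Rightarrow> nat \<Rightarrow> rat fps" where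
  "Psi_term p q \<Psi> j =
     fps_const (inverse (of_nat p ^ j)) * (\<Psi> oo (fps_const (of_nat p ^ j) * fps_X)) ^ (q ^ j)"

lemma Psi_term_0 [simp]: "Psi_term p q \<Psi> 0 = \<Psi>"
  by (simp add: Psi_term_def)

text \<open>Substituting a series without constant term commutes with powers, and replacing T by
  \<open>p ^ j\<close> T scales the coefficient at n by \<open>p ^ (j * n)\<close>.\<close>

lemma Psi_term_nth:
  "Psi_term p q \<Psi> j $ n = inverse (of_nat p ^ j) * of_nat p ^ (j * n) * (\<Psi> ^ q ^ j) $ n"
proof -
  have "(\<Psi> oo (fps_const (of_nat p ^ j) * fps_X)) ^ (q ^ j) =
      \<Psi> ^ (q ^ j) oo (fps_const (of_nat p ^ j) * fps_X)"
    by (rule fps_compose_power) simp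
  then show ?thesis
    by (simp add: Psi_term_def fps_compose_linear power_mult)
qed

text \<open>The power \<open>\<Psi> ^ (q ^ j)\<close> is divisible by T to the \<open>q ^ j\<close>,
  and n \<le> j < \<open>q ^ j\<close>.\<close>

lemma Psi_term_nth_eq_0:
  assumes "\<Psi> $ 0 = 0" "q \<ge> 2" "n \<le> j"
  shows "Psi_term p q \<Psi> j $ n = 0"
  using startsby_zero_power_prefix[OF assms(1)] less_power_power[OF assms(2,3)]
  by (simp add: Psi_term_nth)

text \<open>T-adic convergence means that each coefficient of the partial sums is eventually
  constant. At index n this happens once N > n, and the summand j = 0 is \<open>\<Psi>\<close>
  itself, so the equation can be solved for \<open>\<Psi> $ n\<close>.\<close>

lemma solves_Psi_equation_iff:
  assumes "\<Psi> $ 0 = 0" "q \<ge> 2"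
  shows "solves_Psi_equation p q \<Psi> \<longleftrightarrow>
    (\<forall>n. \<Psi> $ n = fps_X $ n - (\<Sum>j\<in>{0<..n}. Psi_term p q \<Psi> j $ n))"
proof -
  have stable: "(\<Sum>j<N. Psi_term p q \<Psi> j) $ n = \<Psi> $ n + (\<Sum>j\<in>{0<..n}. Psi_term p q \<Psi> j $ n)"
    if "n < N" for n N
  proof -
    have "(\<Sum>j<N. Psi_term p q \<Psi> j) $ n = (\<Sum>j\<in>insert 0 {0<..n}. Psi_term p q \<Psi> j $ n)"
      unfolding fps_sum_nth using that assms
      by (intro sum.mono_neutral_right) (auto simp: Psi_term_nth_eq_0)
    then show ?thesis by simp
  qed
  have "solves_Psi_equation p q \<Psi> \<longleftrightarrow>
      (\<forall>n. \<forall>\<^sub>F N in sequentially. (\<Sum>j<N. Psi_term p q \<Psi> j) $ n = fps_X $ n)"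
    by (simp add: solves_Psi_equation_def sums_def tendsto_fps_iff Psi_term_def)
  also have "\<dots> \<longleftrightarrow> (\<forall>n. \<forall>\<^sub>F N in sequentially.
      \<Psi> $ n + (\<Sum>j\<in>{0<..n}. Psi_term p q \<Psi> j $ n) = fps_X $ n)"
  proof (intro all_cong1 eventually_cong[OF eventually_gt_at_top])
    fix n N :: nat
    assume "n < N"
    then show "((\<Sum>j<N. Psi_term p q \<Psi> j) $ n = fps_X $ n) \<longleftrightarrow>
        \<Psi> $ n + (\<Sum>j\<in>{0<..n}. Psi_term p q \<Psi> j $ n) = fps_X $ n"
      by (simp add: stable)
  qed
  also have "\<dots> \<longleftrightarrow> (\<forall>n. \<Psi> $ n = fps_X $ n - (\<Sum>j\<in>{0<..n}. Psi_term p q \<Psi> j $ n))"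
    by (simp add: eq_diff_eq)
  finally show ?thesis .
qed

lemma Psi_term_nth_cong:
  assumes "F $ 0 = 0" "G $ 0 = 0" "q \<ge> 2" "j > 0" "\<And>k. k < n \<Longrightarrow> F $ k = G $ k"
  shows "Psi_term p q F j $ n = Psi_term p q G j $ n"
proof -
  have "q ^ j \<ge> 2"
    using less_power_power[of q 1 j] assms by simp
  then show ?thesis
    using fps_power_nth_cong_less[OF assms(1,2) _ assms(5)] by (simp add: Psi_term_nth)
qed

lemma Psi_term_nth_Ints:
  assumes "p > 0" "n > 0" "\<And>k. k \<le> n \<Longrightarrow> F $ k \<in> \<int>"
  shows "Psi_term p q F j $ n \<in> \<int>"
proof -
  have "j * n = j + j * (n - 1)"
    using \<open>n > 0\<close> by (cases n) auto
  then have "inverse (of_nat p ^ j) * of_nat p ^ (j * n) = (of_nat p ^ (j * (n - 1)) :: rat)"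
    using \<open>p > 0\<close> by (simp add: power_add)
  then show ?thesis
    using fps_power_nth_Ints[of n F, OF assms(3)] by (simp add: Psi_term_nth)
qed

text \<open>Cutting the series off at n makes the recursive calls visibly decreasing. The default 0
  does no harm, because the summands with j > 0 only see coefficients below n.\<close>

function Psi_coeff :: "nat \<Rightarrow> nat \<Rightarrow> nat \<Rightarrow> rat" where
  "Psi_coeff p q n = fps_X $ n -
     (\<Sum>j\<in>{0<..n}. Psi_term p q (Abs_fps (\<lambda>k. if k < n then Psi_coeff p q k else 0)) j $ n)"
  by auto
termination by (relation "measure (\<lambda>(p, q, n). n)") auto

declare Psi_coeff.simps [simp del]

definition Psi :: "nat \<Rightarrow> nat \<Rightarrow> rat fps" where
  "Psi p q = Abs_fps (Psi_coeff p q)"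

lemma Psi_nth_0: "Psi p q $ 0 = 0"
  by (simp add: Psi_def Psi_coeff.simps)

lemma Psi_nth_Ints:
  assumes "p > 0"
  shows "Psi p q $ n \<in> \<int>"
proof (induction n rule: less_induct)
  case (less n)
  then show ?case
    unfolding Psi_def fps_nth_Abs_fps Psi_coeff.simps[of p q n]
    using assms
    \<comment> \<open>The truncated series has coefficient 0 at n, hence is integral up to n; a
      nonempty index range forces n > 0.\<close>
    by (intro Ints_diff Ints_sum Psi_term_nth_Ints) (auto simp: Psi_def)
qed

lemma Psi_solves:
  assumes "q \<ge> 2"
  shows "solves_Psi_equation p q (Psi p q)"
  unfolding solves_Psi_equation_iff[OF Psi_nth_0 assms]
proof
  fix n
  have "Psi_term p q (Abs_fps (\<lambda>k. if k < n then Psi_coeff p q k else 0)) j $ n =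
      Psi_term p q (Psi p q) j $ n" if "j > 0" for j
    using Psi_nth_0[of p q] assms that by (intro Psi_term_nth_cong) (auto simp: Psi_def)
  then show "Psi p q $ n = fps_X $ n - (\<Sum>j\<in>{0<..n}. Psi_term p q (Psi p q) j $ n)"
    by (simp add: Psi_def Psi_coeff.simps[of p q n])
qed

text \<open>At n = 1 the only correction is the summand j = 1, which starts in degree q \<ge>
  2.\<close>

lemma solves_Psi_equation_nth_1:
  assumes "\<Psi> $ 0 = 0" "q \<ge> 2" "solves_Psi_equation p q \<Psi>"
  shows "\<Psi> $ 1 = 1"
proof -
  have "{0<..1::nat} = {1}" by auto
  moreover have "Psi_term p q \<Psi> 1 $ 1 = 0"
    using assms by (intro Psi_term_nth_eq_0) auto
  ultimately show ?thesis
    using assms solves_Psi_equation_iff[OF assms(1,2), of p]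
    by (auto dest: spec[of _ 1])
qed

text \<open>By strong induction: the correction sum at n agrees for two solutions that agree below
  n.\<close>

lemma solves_Psi_equation_unique:
  assumes "F $ 0 = 0" "G $ 0 = 0" "q \<ge> 2"
    and "solves_Psi_equation p q F" "solves_Psi_equation p q G"
  shows "F = G"
proof (rule fps_ext)
  fix n
  show "F $ n = G $ n"
  proof (induction n rule: less_induct)
    case (less n)
    have "(\<Sum>j\<in>{0<..n}. Psi_term p q F j $ n) = (\<Sum>j\<in>{0<..n}. Psi_term p q G j $ n)"
      using assms less by (intro sum.cong Psi_term_nth_cong) auto
    then show ?case
      using assms solves_Psi_equation_iff by metis
  qed
qed

theorem proposition2p1:
  fixes p q f :: nat
  assumes "prime p" and "f \<ge> 1" and "q = p ^ f"
  shows "\<exists>!\<Psi>. \<Psi> \<in> T_plus_T2_int_fps \<and> solves_Psi_equation p q \<Psi>"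
proof (rule ex1I)
  have p: "p \<ge> 2"
    using \<open>prime p\<close> by (rule prime_ge_2_nat)
  then have q: "q \<ge> 2"
    using less_power_power[OF p \<open>f \<ge> 1\<close>] \<open>q = p ^ f\<close> by simp
  show "Psi p q \<in> T_plus_T2_int_fps \<and> solves_Psi_equation p q (Psi p q)"
    using p Psi_solves[OF q, of p] Psi_nth_0[of p q] Psi_nth_Ints[of p q]
      solves_Psi_equation_nth_1[OF Psi_nth_0 q Psi_solves[OF q], of p]
    by (simp add: mem_T_plus_T2_int_fps_iff)
  show "\<Psi> = Psi p q" if "\<Psi> \<in> T_plus_T2_int_fps \<and> solves_Psi_equation p q \<Psi>" for \<Psi>
    using that q Psi_nth_0 Psi_solves
    by (intro solves_Psi_equation_unique) (auto simp: mem_T_plus_T2_int_fps_iff)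
qed

end
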